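(* Suppose that the turn $G_{a,b}$ is precise, and that $S$ is an equilibrium strategy for the player with advantage in $G_{a,b}$. Then its reverse $\mathcal{R}(S)$ is an equilibrium strategy for the player without advantage in $G_{a,b}$.
   Context: All-pay bidding game. The underlying game is a two-player zero-sum game played by moving a token on a finite acyclic directed graph with two marked vertices $\mathcal{A}$ and $\mathcal{B}$; edges are coloured red or blue, player $A$ may move the token only along red edges and player $B$ only along blue edges. $A$ wins if the token reaches $\mathcal{A}$, $B$ wins if it reaches $\mathcal{B}$, and there are no ties. $\mathcal{S}_A(G)$ (resp. $\mathcal{S}_B(G)$) is the set of positions $A$ (resp. $B$) can move to from position $G$. $G_{a,b}$ denotes a single turn at (unmarked) position $G$ when $A$ holds $a$ chips and $B$ holds $b$ chips: simultaneously $A$ bids $j\in\{0,\dots,a\}$ and $B$ bids $i\in\{0,\dots,b\}$; each pays his bid to the other, so afterwards $A$ has $a-j+i$ and $B$ has $b-i+j$ chips. The higher bidder wins the bid; when bids are equal the bid is won by the player with advantage, who is the player holding more chips before the bid ($A$ if $a=b$). The bid winner decides which player makes the next move. Payoffs. $v_A(G_{a,b})\in[0,1]$ is the probability that $A$ wins under optimal play: it is $1$ at $\mathcal{A}$, $0$ at $\mathcal{B}$, and otherwise is the value of the zero-sum matrix game with the following payoff matrix. $M_A=M_A(G_{a,b})$ is the $(b+1)\times(a+1)$ matrix, indexed from $0$, whose $(i,j)$ entry is $A$'s probability of winning after $A$ bids $j$ and $B$ bids $i$: with $p=\max_{G'\in\mathcal{S}_A(G)}v_A(G'_{a-j+i,b-i+j})$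 and $q=\min_{G'\in\mathcal{S}_B(G)}v_A(G'_{a-j+i,b-i+j})$ (an empty max/min is omitted), the entry is $\max(p,q)$ if $A$ wins the bid and $\min(p,q)$ if $B$ wins the bid. $M_B$ is the analogous $(a+1)\times(b+1)$ matrix for $B$ (row = $A$'s bid, column = $B$'s bid), and $v_B=1-v_A$. Strategies. A strategy for $A$ (resp. $B$) is a probability vector with entries indexed $0,\dots,a$ (resp. $0,\dots,b$), the $i$-th entry being the probability of bidding $i$. If $A$ plays $S_A$ and $B$ plays $S_B$, $A$'s payoff is $S_B^TM_AS_A$ and $B$'s payoff is $S_A^TM_BS_B$. An equilibrium (= optimal) strategy is one belonging to a Nash equilibrium $(S_A,S_B)$ of this game, equivalently one maximizing the player's minimum payoff. Precise: $G_{a,b}$ is precise if in every successor state it is strictly better to have one more chip, i.e. for each position $G'\in\mathcal{S}_A(G)\cup\mathcal{S}_B(G)$, $v_A(G'_{c,a+b-c})$ is strictly increasing in $c\in\{0,\dots,a+b\}$. Length and reverse: $S$ has length $\ell=\ell(S)$ if $S_{\ell-1}\neq0$ and $S_m=0$ for all $m\ge\ell$. For $S=(s_0,\dots,s_{\ell-1},0,\dots,0)$ of length $\ell$, $\mathcal{R}(S)=(s_{\ell-1},s_{\ell-2},\dots,s_0,0,\dots,0)$, with the number of trailing zeros being that appropriate to the player using it. *)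

theory Defs
  imports Complex_Main "Jordan_Normal_Form.Matrix"
begin

definition strategies :: "nat \<Rightarrow> real vec set" where
  "strategies n = {s \<in> carrier_vec (n + 1). (\<forall>i\<le>n. 0 \<le> s $ i) \<and> (\<Sum>i\<le>n. s $ i) = 1}"

definition payoff :: "real mat \<Rightarrow> real vec \<Rightarrow> real vec \<Rightarrow> real" where
  "payoff M y x = y \<bullet> (M *\<^sub>v x)"

text \<open>The value of the zero-sum game in which the maximizing player chooses a column and the
  minimizing player a row; \<^term>\<open>M\<close> is assumed to have at least one row and one column.\<close>

definition game_value :: "real mat \<Rightarrow> real" where
  "game_value M =
    (SUP x \<in> strategies (dim_col M - 1). INF y \<in> strategies (dim_row M - 1). payoff M y x)"

text \<open>The payoff of a player once the bids are known: \<^term>\<open>own\<close> and \<^term>\<open>opp\<close> are the sets of his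
  winning probabilities after his own possible moves and after those of the opponent, and
  \<^term>\<open>wins\<close> says whether he won the bid, hence chooses who moves. A player without a move cannot
  be chosen to move, so the corresponding term is then left out.\<close>

definition turn_payoff :: "bool \<Rightarrow> real set \<Rightarrow> real set \<Rightarrow> real" where
  "turn_payoff wins own opp =
    (let R = (if own = {} then {} else {Max own}) \<union> (if opp = {} then {} else {Min opp})
     in if wins then Max R else Min R)"

definition advantage_A :: "nat \<Rightarrow> nat \<Rightarrow> bool" where
  "advantage_A a b \<longleftrightarrow> b \<le> a"

definition wins_bid_A :: "nat \<Rightarrow> nat \<Rightarrow> nat \<Rightarrow> nat \<Rightarrow> bool" where
  "wins_bid_A a b j i \<longleftrightarrow> i < j \<or> (i = j \<and> advantage_A a b)"

definition strategy_length :: "real vec \<Rightarrow> nat" where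
  "strategy_length S = (THE l. 0 < l \<and> l \<le> dim_vec S \<and> S $ (l - 1) \<noteq> 0 \<and>
    (\<forall>m. l \<le> m \<and> m < dim_vec S \<longrightarrow> S $ m = 0))"

text \<open>The reverse of \<^term>\<open>S\<close>, padded with zeros for a player with \<^term>\<open>n\<close> chips. If
  \<^term>\<open>S\<close> has length greater than \<^term>\<open>n + 1\<close>, nothing is cut off, and the result has the wrong
  dimension to be a strategy of that player.\<close>

definition reverse_strategy :: "nat \<Rightarrow> real vec \<Rightarrow> real vec" where
  "reverse_strategy n S =
    vec (max (n + 1) (strategy_length S))
      (\<lambda>i. if i < strategy_length S then S $ (strategy_length S - 1 - i) else 0)"

record 'v bidding_graph =
  positions :: "'v set"
  red :: "('v \<times> 'v) set"
  blue :: "('v \<times> 'v) set"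
  mark_A :: 'v
  mark_B :: 'v

text \<open>A pair may be both a red and a blue edge. The last assumption excludes ties: play stops only
  at a marked position.\<close>

locale bidding_game =
  fixes \<Gamma> :: "'v bidding_graph"
  assumes finite_positions: "finite (positions \<Gamma>)"
    and red_edges: "red \<Gamma> \<subseteq> positions \<Gamma> \<times> positions \<Gamma>"
    and blue_edges: "blue \<Gamma> \<subseteq> positions \<Gamma> \<times> positions \<Gamma>"
    and acyclic_edges: "acyclic (red \<Gamma> \<union> blue \<Gamma>)"
    and mark_A_position: "mark_A \<Gamma> \<in> positions \<Gamma>"
    and mark_B_position: "mark_B \<Gamma> \<in> positions \<Gamma>"
    and marks_distinct: "mark_A \<Gamma> \<noteq> mark_B \<Gamma>"
    and no_ties: "\<And>G. G \<in> positions \<Gamma> \<Longrightarrow> G \<noteq> mark_A \<Gamma> \<Longrightarrow> G \<noteq> mark_B \<Gamma> \<Longrightarrow>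
      \<exists>G'. (G, G') \<in> red \<Gamma> \<union> blue \<Gamma>"
begin

definition moves_A :: "'v \<Rightarrow> 'v set" where
  "moves_A G = red \<Gamma> `` {G}"

definition moves_B :: "'v \<Rightarrow> 'v set" where
  "moves_B G = blue \<Gamma> `` {G}"

lemma wf_moves: "wf ((red \<Gamma> \<union> blue \<Gamma>)\<inverse>)"
proof -
  have "finite (red \<Gamma> \<union> blue \<Gamma>)"
    using red_edges blue_edges finite_positions
    by (metis finite_SigmaI finite_UnI finite_subset)
  then show ?thesis
    using acyclic_edges by (rule finite_acyclic_wf_converse)
qed

text \<open>\<^term>\<open>v_A G a b\<close> is the probability that A wins from \<^term>\<open>G\<close> when A holds \<^term>\<open>a\<close> and B
  holds \<^term>\<open>b\<close> chips. The matrix is \<open>M_A G a b\<close> below, see \<open>v_A_eq_game_value\<close>.\<close>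

function v_A :: "'v \<Rightarrow> nat \<Rightarrow> nat \<Rightarrow> real" where
  "v_A G a b =
    (if G = mark_A \<Gamma> then 1
     else if G = mark_B \<Gamma> then 0
     else game_value (mat (b + 1) (a + 1) (\<lambda>(i, j). turn_payoff (wins_bid_A a b j i)
       ((\<lambda>G'. v_A G' (a - j + i) (b - i + j)) ` moves_A G)
       ((\<lambda>G'. v_A G' (a - j + i) (b - i + j)) ` moves_B G))))"
  by pat_completeness auto
termination
  by (relation "inv_image ((red \<Gamma> \<union> blue \<Gamma>)\<inverse>) fst")
    (auto simp: wf_moves moves_A_def moves_B_def)

declare v_A.simps [simp del]

definition v_B :: "'v \<Rightarrow> nat \<Rightarrow> nat \<Rightarrow> real" where
  "v_B G a b = 1 - v_A G a b"

text \<open>Rows are bids of B and columns bids of A.\<close>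

definition M_A :: "'v \<Rightarrow> nat \<Rightarrow> nat \<Rightarrow> real mat" where
  "M_A G a b = mat (b + 1) (a + 1) (\<lambda>(i, j). turn_payoff (wins_bid_A a b j i)
    ((\<lambda>G'. v_A G' (a - j + i) (b - i + j)) ` moves_A G)
    ((\<lambda>G'. v_A G' (a - j + i) (b - i + j)) ` moves_B G))"

text \<open>Rows are bids of A and columns bids of B.\<close>

definition M_B :: "'v \<Rightarrow> nat \<Rightarrow> nat \<Rightarrow> real mat" where
  "M_B G a b = mat (a + 1) (b + 1) (\<lambda>(j, i). turn_payoff (\<not> wins_bid_A a b j i)
    ((\<lambda>G'. v_B G' (a - j + i) (b - i + j)) ` moves_B G)
    ((\<lambda>G'. v_B G' (a - j + i) (b - i + j)) ` moves_A G))"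

lemma v_A_eq_game_value:
  assumes "G \<noteq> mark_A \<Gamma>" and "G \<noteq> mark_B \<Gamma>"
  shows "v_A G a b = game_value (M_A G a b)"
  using assms by (subst v_A.simps) (simp add: M_A_def)

definition nash_equilibrium :: "'v \<Rightarrow> nat \<Rightarrow> nat \<Rightarrow> real vec \<Rightarrow> real vec \<Rightarrow> bool" where
  "nash_equilibrium G a b S_A S_B \<longleftrightarrow>
    S_A \<in> strategies a \<and> S_B \<in> strategies b \<and>
    (\<forall>x \<in> strategies a. payoff (M_A G a b) S_B x \<le> payoff (M_A G a b) S_B S_A) \<and>
    (\<forall>y \<in> strategies b. payoff (M_B G a b) S_A y \<le> payoff (M_B G a b) S_A S_B)"

definition equilibrium_A :: "'v \<Rightarrow> nat \<Rightarrow> nat \<Rightarrow> real vec \<Rightarrow> bool" where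
  "equilibrium_A G a b S \<longleftrightarrow> (\<exists>S_B. nash_equilibrium G a b S S_B)"

definition equilibrium_B :: "'v \<Rightarrow> nat \<Rightarrow> nat \<Rightarrow> real vec \<Rightarrow> bool" where
  "equilibrium_B G a b S \<longleftrightarrow> (\<exists>S_A. nash_equilibrium G a b S_A S)"

definition precise :: "'v \<Rightarrow> nat \<Rightarrow> nat \<Rightarrow> bool" where
  "precise G a b \<longleftrightarrow>
    (\<forall>G' \<in> moves_A G \<union> moves_B G. strict_mono_on {0..a + b} (\<lambda>c. v_A G' c (a + b - c)))"

end

end

theory Submission
  imports Defs
begin

text \<open>The payoff depends on the bids only through their difference. Let \<open>S\<close> be optimal for the player
  with advantage and \<open>T\<close> for the other. If a bid \<open>j > 0\<close> has positive weight in \<open>S\<close>, so it has in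
  \<open>T\<close>, for otherwise the bid \<open>j - 1\<close> would win against the same bids and be cheaper; in the same way
  weight of \<open>T\<close> at \<open>i > 0\<close> forces weight of \<open>S\<close> at \<open>i - 1\<close>. Hence the support of \<open>S\<close> is
  \<open>{0, \<dots>, \<ell> - 1}\<close>, and complementary slackness makes \<open>S\<close> yield exactly the value against each of the
  bids \<open>1, \<dots>, \<ell> - 1\<close>; a descent on the length gives the same for the bid 0. The bid \<open>j < \<ell>\<close> against
  the reverse of \<open>S\<close> is the same as \<open>S\<close> against the bid \<open>\<ell> - 1 - j\<close>, so it yields the value, and
  higher bids yield less.\<close>

section \<open>Finitely supported weights and their averages\<close>

definition mixed :: "nat \<Rightarrow> (nat \<Rightarrow> real) \<Rightarrow> bool" where
  "mixed k p \<longleftrightarrow> (\<forall>i. 0 \<le> p i) \<and> (\<forall>i>k. p i = 0) \<and> (\<Sum>i\<le>k. p i) = 1"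

lemma mixed_pos_le: "mixed k p \<Longrightarrow> 0 < p i \<Longrightarrow> i \<le> k"
  unfolding mixed_def by (metis less_irrefl not_le)

lemma mixed_ex_pos:
  assumes "mixed k p"
  obtains i where "i \<le> k" "0 < p i"
proof -
  have "\<exists>i\<le>k. p i \<noteq> 0"
  proof (rule ccontr)
    assume "\<not> ?thesis"
    then have "(\<Sum>i\<le>k. p i) = 0" by simp
    with assms show False by (simp add: mixed_def)
  qed
  then show ?thesis using assms that unfolding mixed_def by (metis less_eq_real_def)
qed

lemma mixed_sum_less:
  assumes "mixed k p" and "\<And>i. i \<le> k \<Longrightarrow> 0 < p i \<Longrightarrow> g i < h i"
  shows "(\<Sum>i\<le>k. p i * g i) < (\<Sum>i\<le>k. p i * (h i :: real))"
proof -
  obtain i where i: "i \<le> k" "0 < p i" using assms(1) by (rule mixed_ex_pos)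
  have nn: "0 \<le> p i" for i using assms(1) by (simp add: mixed_def)
  show ?thesis
  proof (rule sum_strict_mono_ex1)
    show "\<forall>i\<in>{..k}. p i * g i \<le> p i * h i"
    proof
      fix i assume i: "i \<in> {..k}"
      show "p i * g i \<le> p i * h i"
      proof (cases "p i = 0")
        case False
        then have "0 < p i" using nn[of i] by simp
        with assms(2)[of i] i show ?thesis by (simp add: mult_left_mono)
      qed simp
    qed
    show "\<exists>i\<in>{..k}. p i * g i < p i * h i"
      using i assms(2)[of i] by (intro bexI[of _ i]) (auto simp: mult_strict_left_mono)
  qed simp
qed

text \<open>An average of numbers at least \<open>c\<close> can be at most \<open>c\<close> only if
  no number of positive weight exceeds \<open>c\<close>.\<close>

lemma mixed_sum_eq_bound:
  assumes "mixed k p" and "\<And>i. i \<le> k \<Longrightarrow> c \<le> g i" and "(\<Sum>i\<le>k. p i * g i) \<le> c"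
    and "0 < p i"
  shows "g i = (c :: real)"
proof -
  have nn: "0 \<le> p i" for i using assms(1) by (simp add: mixed_def)
  have ik: "i \<le> k" using assms(1,4) by (rule mixed_pos_le)
  have "(\<Sum>i\<le>k. p i * (g i - c)) = (\<Sum>i\<le>k. p i * g i) - (\<Sum>i\<le>k. p i) * c"
    by (simp add: right_diff_distrib sum_subtractf sum_distrib_right)
  also have "\<dots> \<le> 0" using assms(1,3) by (simp add: mixed_def)
  finally have le: "(\<Sum>i\<le>k. p i * (g i - c)) \<le> 0" .
  have "0 \<le> p i * (g i - c)" if "i \<le> k" for i using nn assms(2)[OF that] by simp
  then have "(\<Sum>i\<le>k. p i * (g i - c)) = 0"
    using le by (intro antisym sum_nonneg) auto
  then have "p i * (g i - c) = 0"
    using ik nn assms(2) by (subst (asm) sum_nonneg_eq_0_iff) auto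
  with assms(4) show ?thesis by simp
qed

text \<open>A ratio test: the entries of \<open>d\<close> sum to 0 but do not all vanish, so some
  are negative; \<open>t\<close> is the smallest \<open>x i / - d i\<close> among those, attained at
  \<open>k\<close>.\<close>

lemma ray_leaves_orthant:
  fixes x d :: "nat \<Rightarrow> real"
  assumes "\<And>i. i < l \<Longrightarrow> 0 < x i" and "(\<Sum>i<l. d i) = 0" and "\<exists>i<l. d i \<noteq> 0"
  obtains t k where "0 \<le> t" "\<And>i. i < l \<Longrightarrow> 0 \<le> x i + t * d i" "k < l" "x k + t * d k = 0"
proof -
  define N where "N = {i. i < l \<and> d i < 0}"
  have fin: "finite N" by (simp add: N_def)
  have ne: "N \<noteq> {}"
  proof
    assume "N = {}"
    then have "0 \<le> d i" if "i < l" for i using that by (metis (mono_tags, lifting) N_def empty_iff mem_Collect_eq not_le)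
    then have "\<forall>i\<in>{..<l}. d i = 0" using assms(2) by (subst (asm) sum_nonneg_eq_0_iff) auto
    with assms(3) show False by auto
  qed
  define t where "t = Min ((\<lambda>i. x i / - d i) ` N)"
  have "t \<in> (\<lambda>i. x i / - d i) ` N" unfolding t_def using fin ne by (intro Min_in) auto
  then obtain k where k: "k \<in> N" "t = x k / - d k" by auto
  have le: "t \<le> x i / - d i" if "i \<in> N" for i unfolding t_def using fin that by simp
  have t0: "0 \<le> t" using k assms(1)[of k] by (auto simp: N_def divide_nonneg_neg)
  show thesis
  proof (rule that[of t k])
    show "0 \<le> t" by (rule t0)
    show "k < l" "x k + t * d k = 0" using k by (auto simp: N_def)
    fix i assume i: "i < l"
    show "0 \<le> x i + t * d i"
    proof (cases "d i < 0")
      case True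
      with i le[of i] have "t \<le> x i / - d i" by (simp add: N_def)
      then have "t * - d i \<le> x i" using True by (simp add: pos_le_divide_eq[of "- d i"] del: divide_minus_right)
      then show ?thesis by simp
    next
      case False
      then show ?thesis using t0 assms(1)[OF i] by simp
    qed
  qed
qed

section \<open>Payoffs depending on the bid difference\<close>

text \<open>The advantaged player, with \<^term>\<open>m\<close> chips, maximizes and chooses the column \<open>j\<close>; the
  other chooses the row \<open>i\<close>. The chips after the turn, hence the payoff \<^term>\<open>f (j - i)\<close>, depend
  only on the bid difference. Nothing relates the values of \<^term>\<open>f\<close> on the two sides of 0, where
  the bid winner changes.\<close>

locale bid_difference_game =
  fixes f :: "int \<Rightarrow> real" and m n :: nat
  assumes n_le_m: "n \<le> m"
    and win_decreasing: "\<And>d e. 0 \<le> d \<Longrightarrow> d < e \<Longrightarrow> e \<le> int m \<Longrightarrow> f e < f d"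
    and lose_decreasing: "\<And>d e. - int n \<le> d \<Longrightarrow> d < e \<Longrightarrow> e < 0 \<Longrightarrow> f e < f d"
begin

definition row_payoff :: "(nat \<Rightarrow> real) \<Rightarrow> nat \<Rightarrow> real" where
  "row_payoff s i = (\<Sum>j\<le>m. s j * f (int j - int i))"

definition col_payoff :: "(nat \<Rightarrow> real) \<Rightarrow> nat \<Rightarrow> real" where
  "col_payoff t j = (\<Sum>i\<le>n. t i * f (int j - int i))"

text \<open>A common \<open>v\<close> secured by both sides is the value and makes both strategies
  optimal, so no minimax theorem has to be invoked.\<close>

definition secures_max :: "real \<Rightarrow> (nat \<Rightarrow> real) \<Rightarrow> bool" where
  "secures_max v s \<longleftrightarrow> mixed m s \<and> (\<forall>i\<le>n. v \<le> row_payoff s i)"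

definition secures_min :: "real \<Rightarrow> (nat \<Rightarrow> real) \<Rightarrow> bool" where
  "secures_min v t \<longleftrightarrow> mixed n t \<and> (\<forall>j\<le>m. col_payoff t j \<le> v)"

lemma sum_row_eq_sum_col: "(\<Sum>i\<le>n. t i * row_payoff s i) = (\<Sum>j\<le>m. s j * col_payoff t j)"
  unfolding row_payoff_def col_payoff_def sum_distrib_left
  by (subst sum.swap) (simp add: mult.left_commute)

text \<open>Only the step from -1 to 0 crosses the change of bid winner, hence the exclusion of
  \<open>d = 0\<close>.\<close>

lemma f_step: "d \<noteq> 0 \<Longrightarrow> - int n < d \<Longrightarrow> d \<le> int m \<Longrightarrow> f d < f (d - 1)"
  using win_decreasing[of "d - 1" d] lose_decreasing[of "d - 1" d] by linarith

text \<open>Ties go to the maximizer, so raising \<open>j\<close> to \<open>j + 1\<close> changes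
  the winner only against the bid \<open>j + 1\<close>; otherwise it just costs a chip. The
  alternative \<open>t 0 = 0\<close> admits the fictitious bid \<open>m + 1\<close>: the differences
  that carry weight are still at most \<open>m\<close>.\<close>

lemma col_step_less:
  assumes "mixed n t" and "t (Suc j) = 0" and "Suc j \<le> m \<or> j \<le> m \<and> t 0 = 0"
  shows "col_payoff t (Suc j) < col_payoff t j"
  unfolding col_payoff_def
proof (rule mixed_sum_less[OF assms(1)])
  fix i assume "i \<le> n" "0 < t i"
  then have "i \<noteq> Suc j" "int (Suc j) - int i \<le> int m" using assms(2,3) by (cases "i = 0"; auto)+
  then show "f (int (Suc j) - int i) < f (int j - int i)"
    using f_step[of "int (Suc j) - int i"] \<open>i \<le> n\<close> by (auto simp: algebra_simps)
qed

text \<open>The minimizer gains the bid by going from \<open>i\<close> to \<open>i + 1\<close> only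
  against \<open>i\<close>; otherwise the extra chip is given away.\<close>

lemma row_step_less:
  assumes "mixed m s" and "s i = 0" and "Suc i \<le> n"
  shows "row_payoff s i < row_payoff s (Suc i)"
  unfolding row_payoff_def
proof (rule mixed_sum_less[OF assms(1)])
  fix j assume "j \<le> m" "0 < s j"
  then have "j \<noteq> i" using assms(2) by auto
  then show "f (int j - int i) < f (int j - int (Suc i))"
    using f_step[of "int j - int i"] \<open>j \<le> m\<close> assms(3) by (auto simp: algebra_simps)
qed

section \<open>Complementary slackness, supports and tight rows\<close>

context
  fixes v t
  assumes t: "secures_min v t"
begin

lemma secures_min_mixed: "mixed n t" and secures_min_col_le: "j \<le> m \<Longrightarrow> col_payoff t j \<le> v"
  using t by (auto simp: secures_min_def)

text \<open>Complementary slackness: the \<open>t\<close>-average of the rows equals the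
  \<open>s\<close>-average of the columns, hence is at most \<open>v\<close>, while every row pays
  at least \<open>v\<close>.\<close>

lemma row_eq:
  assumes s: "secures_max v s" and "0 < t i"
  shows "row_payoff s i = v"
proof (rule mixed_sum_eq_bound[OF secures_min_mixed])
  show "v \<le> row_payoff s i" if "i \<le> n" for i using s that by (simp add: secures_max_def)
  have nn: "0 \<le> s j" for j using s by (simp add: secures_max_def mixed_def)
  have "(\<Sum>j\<le>m. s j * col_payoff t j) \<le> (\<Sum>j\<le>m. s j * v)"
    by (intro sum_mono mult_left_mono secures_min_col_le nn) auto
  also have "\<dots> = v" using s by (simp add: secures_max_def mixed_def flip: sum_distrib_right)
  finally show "(\<Sum>i\<le>n. t i * row_payoff s i) \<le> v" by (simp add: sum_row_eq_sum_col)
qed fact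

lemma col_eq:
  assumes s: "secures_max v s" and "0 < s j"
  shows "col_payoff t j = v"
proof -
  have "- col_payoff t j = - v"
  proof (rule mixed_sum_eq_bound[of m s])
    show "mixed m s" using s by (simp add: secures_max_def)
    have nn: "0 \<le> t i" for i using secures_min_mixed by (simp add: mixed_def)
    have "v = (\<Sum>i\<le>n. t i * v)" using secures_min_mixed by (simp add: mixed_def flip: sum_distrib_right)
    also have "\<dots> \<le> (\<Sum>i\<le>n. t i * row_payoff s i)"
      using s by (intro sum_mono mult_left_mono nn) (auto simp: secures_max_def)
    finally show "(\<Sum>j\<le>m. s j * - col_payoff t j) \<le> - v" by (simp add: sum_row_eq_sum_col sum_negf)
  qed (use secures_min_col_le assms in auto)
  then show ?thesis by simp
qed

lemma support_max_imp_min: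
  assumes s: "secures_max v s" and "0 < s (Suc j)"
  shows "0 < t (Suc j)"
proof (rule ccontr)
  assume "\<not> ?thesis"
  then have z: "t (Suc j) = 0" using secures_min_mixed by (metis mixed_def less_eq_real_def)
  have "Suc j \<le> m" using s assms(2) by (meson mixed_pos_le secures_max_def)
  with z have "col_payoff t (Suc j) < col_payoff t j" by (intro col_step_less secures_min_mixed) auto
  with col_eq[OF assms] secures_min_col_le[of j] \<open>Suc j \<le> m\<close> show False by simp
qed

lemma support_min_imp_max:
  assumes s: "secures_max v s" and "0 < t (Suc i)"
  shows "0 < s i"
proof (rule ccontr)
  assume "\<not> ?thesis"
  then have z: "s i = 0" using s by (metis mixed_def secures_max_def less_eq_real_def)
  have "Suc i \<le> n" using secures_min_mixed assms(2) by (rule mixed_pos_le)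
  with z have "row_payoff s i < row_payoff s (Suc i)" using s by (intro row_step_less) (auto simp: secures_max_def)
  with row_eq[OF assms] s \<open>Suc i \<le> n\<close> show False by (simp add: secures_max_def not_less[symmetric])
qed

text \<open>Weight of \<open>s\<close> at \<open>j + 1\<close> forces weight of \<open>t\<close>
  there and hence weight of \<open>s\<close> at \<open>j\<close>. As \<open>t\<close> lives on bids
  up to \<open>n\<close>, so does \<open>s\<close>, which lets the reverse fit the other
  player.\<close>

lemma support_initial:
  assumes s: "secures_max v s"
  obtains l where "0 < l" "l \<le> Suc n" "\<And>j. 0 < s j \<longleftrightarrow> j < l"
proof -
  have down: "0 < s k" if "0 < s j" "k \<le> j" for j k
    using that(2,1)
    by (induction rule: inc_induct) (auto intro: support_max_imp_min[OF s] support_min_imp_max[OF s])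
  have le: "j \<le> n" if "0 < s j" for j
    using that support_max_imp_min[OF s] mixed_pos_le[OF secures_min_mixed] by (cases j) auto
  define l where "l = (LEAST j. \<not> 0 < s j)"
  have l: "\<not> 0 < s l" unfolding l_def by (rule LeastI[of _ "Suc n"]) (use le in fastforce)
  have iff: "0 < s j \<longleftrightarrow> j < l" for j
    using l down[of j l] not_less_Least[of j "\<lambda>j. \<not> 0 < s j"] unfolding l_def[symmetric] by force
  obtain j where j: "0 < s j" using s mixed_ex_pos unfolding secures_max_def by metis
  have "l \<le> Suc n" using iff[of "Suc n"] le[of "Suc n"] by force
  with j iff show thesis by (intro that[of l]) auto
qed

text \<open>Row 0 is the case complementary slackness does not reach, since \<^term>\<open>t 0\<close> may vanish. If
  its payoff exceeds \<^term>\<open>v\<close>, let \<open>u j = t (l - j)\<close>. The columns \<open>0, \<dots>, l - 1\<close> of \<^term>\<open>t\<close> become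
  the rows \<open>l, \<dots>, 1\<close> of \<open>u\<close>, so these are tight for \<open>u\<close>, and row 0 pays at most \<^term>\<open>v\<close>.
  Moving from \<^term>\<open>s\<close> away from \<open>u\<close> until an entry vanishes keeps the strategy optimal and row 0
  above \<^term>\<open>v\<close>, but makes it shorter.\<close>

lemma row_zero_eq:
  assumes "secures_max v s" and "\<And>j. 0 < s j \<longleftrightarrow> j < l"
  shows "row_payoff s 0 = v"
  using assms
proof (induction l arbitrary: s rule: less_induct)
  case (less l)
  note s = less.prems(1)
  have s_mixed: "mixed m s" and v_le: "\<And>i. i \<le> n \<Longrightarrow> v \<le> row_payoff s i"
    using s by (auto simp: secures_max_def)
  show ?case
  proof (rule ccontr)
    assume neq: "row_payoff s 0 \<noteq> v"
    have t_nonneg: "0 \<le> t i" for i using secures_min_mixed by (simp add: mixed_def)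
    have t0: "t 0 = 0" using row_eq[OF s, of 0] neq t_nonneg[of 0] by fastforce
    have t_zero: "t i = 0" if "l < i" for i
      using that support_min_imp_max[OF s, of "i - 1"] less.prems(2)[of "i - 1"] t_nonneg[of i] by force
    obtain l' where "l' \<le> Suc n" "\<And>j. 0 < s j \<longleftrightarrow> j < l'"
      using support_initial[OF s] by metis
    then have l_le: "l \<le> Suc n" using less.prems(2) by (metis not_le order_less_irrefl)
    have s_zero: "s j = 0" if "l \<le> j" for j
      using less.prems(2)[of j] that s_mixed by (metis mixed_def less_eq_real_def not_le)
    \<comment> \<open>With no weight at 0 or beyond \<open>l\<close>, \<open>t\<close> lives on
      \<open>1, ..., l\<close>; reflecting by \<open>l - j\<close>, not \<open>l - 1 - j\<close>,
      moves it onto \<open>0, ..., l - 1\<close>.\<close>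
    define u where "u j = (if j < l then t (l - j) else 0)" for j
    have reverse: "(\<Sum>j\<le>m. u j * g j) = (\<Sum>i\<le>n. t i * g (l - i))" for g :: "nat \<Rightarrow> real"
    proof -
      have "(\<Sum>j\<le>m. u j * g j) = (\<Sum>j<l. t (l - j) * g j)"
        using l_le n_le_m by (intro sum.mono_neutral_cong_right) (auto simp: u_def)
      also have "\<dots> = (\<Sum>i\<in>{1..l}. t i * g (l - i))"
        by (rule sum.reindex_bij_witness[of _ "\<lambda>i. l - i" "\<lambda>j. l - j"]) auto
      also have "\<dots> = (\<Sum>i\<le>n. t i * g (l - i))"
        using t0 t_zero secures_min_mixed
        by (intro sum.mono_neutral_cong) (auto simp: mixed_def not_le Suc_le_eq)
      finally show ?thesis .
    qed
    have row_u: "row_payoff u i = col_payoff t (l - i)" if "i \<le> l" for i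
      unfolding row_payoff_def reverse col_payoff_def
    proof (intro sum.cong refl)
      fix k
      show "t k * f (int (l - k) - int i) = t k * f (int (l - i) - int k)"
        using t_zero[of k] that by (cases "k \<le> l") (auto simp: of_nat_diff algebra_simps)
    qed
    have row_u_eq: "row_payoff u i = v" if "0 < i" "i \<le> l" for i
      using that row_u col_eq[OF s] less.prems(2) by simp
    \<comment> \<open>Row 0 of \<open>u\<close> is column \<open>l\<close> of \<open>t\<close>. When
      \<open>l = m + 1\<close> this bid exceeds the stock of chips, but \<open>t 0 = 0\<close> still
      makes the fictitious column pay less than column \<open>m\<close>.\<close>
    have row_u_0: "row_payoff u 0 \<le> v"
    proof (cases "l \<le> m")
      case True
      then show ?thesis using row_u secures_min_col_le by simp
    next
      case False
      then have "l = Suc m" "t (Suc m) = 0" using l_le n_le_m secures_min_mixed by (auto simp: mixed_def)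
      then show ?thesis using row_u[of 0] col_step_less[OF secures_min_mixed, of m] t0 secures_min_col_le[of m] by simp
    qed
    define d where "d j = s j - u j" for j
    have d_zero: "d j = 0" if "l \<le> j" for j using that by (simp add: d_def s_zero u_def)
    have row_d: "row_payoff d i = row_payoff s i - row_payoff u i" for i
      by (simp add: d_def row_payoff_def left_diff_distrib sum_subtractf)
    have "(\<Sum>j\<le>m. u j) = 1" using reverse[of "\<lambda>_. 1"] secures_min_mixed by (simp add: mixed_def)
    then have sum_d: "(\<Sum>j\<le>m. d j) = 0"
      using s_mixed by (simp add: d_def sum_subtractf mixed_def)
    also have "(\<Sum>j\<le>m. d j) = (\<Sum>j<l. d j)"
      using l_le n_le_m d_zero by (intro sum.mono_neutral_right) auto
    finally have "(\<Sum>j<l. d j) = 0" .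
    moreover have "\<exists>j<l. d j \<noteq> 0"
    proof (rule ccontr)
      assume "\<not> ?thesis"
      then have "d j = 0" for j using d_zero by (cases "j < l") auto
      then have "row_payoff d 0 = 0" by (simp add: row_payoff_def)
      with row_d[of 0] row_u_0 v_le[of 0] neq show False by simp
    qed
    ultimately obtain c k where c: "0 \<le> c" "\<And>j. j < l \<Longrightarrow> 0 \<le> s j + c * d j"
        and k: "k < l" "s k + c * d k = 0"
      using ray_leaves_orthant[of l s d] less.prems(2) by blast
    define s' where "s' j = s j + c * d j" for j
    have s'_zero: "s' j = 0" if "l \<le> j" for j using that by (simp add: s'_def s_zero d_zero)
    have s'_mixed: "mixed m s'"
      unfolding mixed_def
    proof (intro conjI allI impI)
      show "0 \<le> s' j" for j using c(2) s'_zero by (cases "j < l") (auto simp: s'_def)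
      show "s' j = 0" if "m < j" for j using that l_le n_le_m by (intro s'_zero) simp
      show "(\<Sum>j\<le>m. s' j) = 1"
        using s_mixed sum_d by (simp add: s'_def sum.distrib mixed_def flip: sum_distrib_left)
    qed
    have row_s': "row_payoff s' i = row_payoff s i + c * (row_payoff s i - row_payoff u i)" for i
      unfolding row_d[symmetric]
      by (simp add: s'_def row_payoff_def distrib_right sum.distrib sum_distrib_left mult.assoc)
    have row_s'_0: "v < row_payoff s' 0"
    proof -
      have "v < row_payoff s 0" using v_le[of 0] neq by simp
      also have "row_payoff s 0 \<le> row_payoff s' 0" using row_u_0 v_le[of 0] c(1) by (simp add: row_s' add_increasing2)
      finally show ?thesis .
    qed
    \<comment> \<open>Moving away from \<open>u\<close> cannot lower rows \<open>1, ..., l\<close>,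
      where \<open>u\<close> pays \<open>v\<close> and \<open>s\<close> at least \<open>v\<close>.
      Later rows exceed their predecessors, as \<open>s'\<close> has no weight from \<open>l\<close>
      on.\<close>
    have "v \<le> row_payoff s' i" if "i \<le> n" for i
      using that
    proof (induction i)
      case 0
      show ?case using row_s'_0 by simp
    next
      case (Suc i)
      show ?case
      proof (cases "Suc i \<le> l")
        case True
        then show ?thesis using row_u_eq[of "Suc i"] v_le[OF Suc.prems] c(1) by (simp add: row_s' add_increasing2)
      next
        case False
        then have "row_payoff s' i < row_payoff s' (Suc i)" using s'_zero Suc.prems by (intro row_step_less s'_mixed) auto
        with Suc show ?thesis by simp
      qed
    qed
    with s'_mixed have s': "secures_max v s'" by (simp add: secures_max_def)
    obtain l' where l': "\<And>j. 0 < s' j \<longleftrightarrow> j < l'" using support_initial[OF s'] by metis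
    have "l' \<le> k" using l'[of k] k(2) by (simp add: s'_def)
    with k(1) have "row_payoff s' 0 = v" by (intro less.IH[OF _ s' l']) simp
    with row_s'_0 show False by simp
  qed
qed

lemma secures_min_reverse:
  assumes s: "secures_max v s" and supp: "\<And>j. 0 < s j \<longleftrightarrow> j < l"
  shows "secures_min v (\<lambda>i. if i < l then s (l - 1 - i) else 0)"
proof -
  define r where "r i = (if i < l then s (l - 1 - i) else 0)" for i
  have s_mixed: "mixed m s" using s by (simp add: secures_max_def)
  obtain l' where "0 < l'" "l' \<le> Suc n" "\<And>j. 0 < s j \<longleftrightarrow> j < l'"
    using support_initial[OF s] by metis
  then have l: "0 < l" "l \<le> Suc n" using supp by (metis not_le order_less_irrefl)+
  have s_zero: "s j = 0" if "l \<le> j" for j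
    using supp[of j] that s_mixed by (metis mixed_def less_eq_real_def not_le)
  have reverse: "(\<Sum>i\<le>n. r i * g i) = (\<Sum>j\<le>m. s j * g (l - 1 - j))" for g :: "nat \<Rightarrow> real"
  proof -
    have "(\<Sum>i\<le>n. r i * g i) = (\<Sum>i<l. s (l - 1 - i) * g i)"
      using l by (intro sum.mono_neutral_cong_right) (auto simp: r_def)
    also have "\<dots> = (\<Sum>j<l. s j * g (l - 1 - j))"
      by (rule sum.reindex_bij_witness[of _ "\<lambda>i. l - 1 - i" "\<lambda>j. l - 1 - j"]) auto
    also have "\<dots> = (\<Sum>j\<le>m. s j * g (l - 1 - j))"
      using l n_le_m s_zero by (intro sum.mono_neutral_left) auto
    finally show ?thesis .
  qed
  have r_mixed: "mixed n r"
    using reverse[of "\<lambda>_. 1"] s_mixed l by (auto simp: mixed_def r_def)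
  have tight: "row_payoff s i = v" if "i < l" for i
  proof (cases i)
    case 0
    then show ?thesis using row_zero_eq[OF s supp] by simp
  next
    case (Suc k)
    then show ?thesis using row_eq[OF s] support_max_imp_min[OF s] supp that by metis
  qed
  have col_r: "col_payoff r j = v" if "j < l" for j
  proof -
    have "col_payoff r j = row_payoff s (l - 1 - j)"
      unfolding row_payoff_def reverse col_payoff_def using s_zero that
    proof (intro sum.cong refl)
      fix k assume "k \<in> {..m}"
      \<comment> \<open>For \<open>k < l\<close> both differences equal
        \<open>j + k - (l - 1)\<close>, which is symmetric in \<open>j\<close> and
        \<open>k\<close>.\<close>
      show "s k * f (int j - int (l - 1 - k)) = s k * f (int k - int (l - 1 - j))"
        using s_zero[of k] that by (cases "k < l") (auto simp: algebra_simps of_nat_diff)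
    qed
    then show ?thesis using tight that by simp
  qed
  have "col_payoff r j \<le> v" if "j \<le> m" for j
    using that
  proof (induction j)
    case 0
    then show ?case using col_r l by simp
  next
    case (Suc j)
    show ?case
    proof (cases "Suc j < l")
      case True
      then show ?thesis using col_r by simp
    next
      case False
      then have "col_payoff r (Suc j) < col_payoff r j" using Suc.prems by (intro col_step_less r_mixed) (auto simp: r_def)
      with Suc show ?thesis by simp
    qed
  qed
  with r_mixed show ?thesis unfolding secures_min_def r_def by simp
qed

end

end

section \<open>Strategies as vectors, optimality as saddle points\<close>

text \<open>Zero padding replaces the unspecified values of vector indexing beyond the dimension, in
  agreement with \<open>mixed\<close>.\<close>

definition entries :: "real vec \<Rightarrow> nat \<Rightarrow> real" where
  "entries x i = (if i < dim_vec x then x $ i else 0)"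

lemma entries_eq: "dim_vec x = k + 1 \<Longrightarrow> i \<le> k \<Longrightarrow> entries x i = x $ i"
  by (simp add: entries_def)

lemma strategies_iff: "x \<in> strategies k \<longleftrightarrow> dim_vec x = k + 1 \<and> mixed k (entries x)"
proof (cases "dim_vec x = k + 1")
  case True
  note eq = entries_eq[OF True]
  have zero: "entries x i = 0" if "k < i" for i using that True by (simp add: entries_def)
  have nonneg: "(\<forall>i. 0 \<le> entries x i) \<longleftrightarrow> (\<forall>i\<le>k. 0 \<le> x $ i)"
    using eq zero by (metis not_le order_refl)
  have sum: "(\<Sum>i\<le>k. entries x i) = (\<Sum>i\<le>k. x $ i)" by (intro sum.cong) (simp_all add: eq)
  show ?thesis
    unfolding strategies_def mixed_def nonneg sum using True zero by (auto intro: carrier_vecI)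
next
  case False
  then show ?thesis unfolding strategies_def by (metis (no_types, lifting) carrier_vecD mem_Collect_eq)
qed

lemma entries_mixed: "x \<in> strategies k \<Longrightarrow> mixed k (entries x)"
  by (simp only: strategies_iff)

lemma unit_vec_strategy: "i \<le> k \<Longrightarrow> unit_vec (k + 1) i \<in> strategies k"
  by (auto simp: strategies_def unit_vec_def)

lemma payoff_eq_sum:
  assumes "x \<in> strategies m" and "y \<in> strategies n"
  shows "payoff (mat (n + 1) (m + 1) F) y x = (\<Sum>i\<le>n. y $ i * (\<Sum>j\<le>m. x $ j * F (i, j)))"
  using assms
  by (auto simp: payoff_def strategies_def scalar_prod_def atLeast0LessThan lessThan_Suc_atMost mult.commute
      intro!: sum.cong)

lemma payoff_one_minus:
  assumes "x \<in> strategies m" and "y \<in> strategies n"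
    and "\<And>i j. i \<le> n \<Longrightarrow> j \<le> m \<Longrightarrow> H (j, i) = 1 - F (i, j)"
  shows "payoff (mat (m + 1) (n + 1) H) x y = 1 - payoff (mat (n + 1) (m + 1) F) y x"
proof -
  have "payoff (mat (m + 1) (n + 1) H) x y = (\<Sum>j\<le>m. x $ j * (\<Sum>i\<le>n. y $ i * (1 - F (i, j))))"
    unfolding payoff_eq_sum[OF assms(2,1)] using assms(3) by (intro sum.cong arg_cong2[of _ _ _ _ "(*)"]) auto
  also have "\<dots> = (\<Sum>j\<le>m. x $ j * (\<Sum>i\<le>n. y $ i)) - (\<Sum>j\<le>m. \<Sum>i\<le>n. x $ j * (y $ i * F (i, j)))"
    by (simp add: right_diff_distrib sum_subtractf sum_distrib_left)
  also have "(\<Sum>j\<le>m. x $ j * (\<Sum>i\<le>n. y $ i)) = 1"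
    using assms by (simp add: strategies_def)
  also have "(\<Sum>j\<le>m. \<Sum>i\<le>n. x $ j * (y $ i * F (i, j))) = payoff (mat (n + 1) (m + 1) F) y x"
    unfolding payoff_eq_sum[OF assms(1,2)]
    by (subst sum.swap) (simp add: sum_distrib_left mult.left_commute)
  finally show ?thesis .
qed

text \<open>Equilibrium of a zero-sum game in terms of one matrix, so that one argument serves
  whichever player has advantage.\<close>

definition saddle_point :: "nat \<Rightarrow> nat \<Rightarrow> real mat \<Rightarrow> real vec \<Rightarrow> real vec \<Rightarrow> bool" where
  "saddle_point m n M x y \<longleftrightarrow> x \<in> strategies m \<and> y \<in> strategies n \<and>
     (\<forall>x' \<in> strategies m. payoff M y x' \<le> payoff M y x) \<and>
     (\<forall>y' \<in> strategies n. payoff M y x \<le> payoff M y' x)"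

context bid_difference_game
begin

definition matrix :: "real mat" where
  "matrix = mat (n + 1) (m + 1) (\<lambda>(i, j). f (int j - int i))"

lemma payoff_eq_row:
  assumes "x \<in> strategies m" and "y \<in> strategies n"
  shows "payoff matrix y x = (\<Sum>i\<le>n. entries y i * row_payoff (entries x) i)"
  using assms unfolding matrix_def
  by (subst payoff_eq_sum) (auto simp: entries_def row_payoff_def strategies_def)

lemma payoff_eq_col:
  assumes "x \<in> strategies m" and "y \<in> strategies n"
  shows "payoff matrix y x = (\<Sum>j\<le>m. entries x j * col_payoff (entries y) j)"
  using assms by (simp add: payoff_eq_row sum_row_eq_sum_col)

lemma payoff_unit_vec_row:
  assumes "x \<in> strategies m" and "i \<le> n"
  shows "payoff matrix (unit_vec (n + 1) i) x = row_payoff (entries x) i"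
proof -
  have "entries (unit_vec (n + 1) i) k * c = (if k = i then c else 0)" if "k \<le> n" for k and c
    using that assms(2) by (auto simp: entries_def)
  then show ?thesis using assms by (simp add: payoff_eq_row unit_vec_strategy del: One_nat_def add_Suc_right)
qed

lemma payoff_unit_vec_col:
  assumes "y \<in> strategies n" and "j \<le> m"
  shows "payoff matrix y (unit_vec (m + 1) j) = col_payoff (entries y) j"
proof -
  have "entries (unit_vec (m + 1) j) k * c = (if k = j then c else 0)" if "k \<le> m" for k and c
    using that assms(2) by (auto simp: entries_def)
  then show ?thesis using assms by (simp add: payoff_eq_col unit_vec_strategy del: One_nat_def add_Suc_right)
qed

lemma saddle_point_secures:
  assumes "saddle_point m n matrix x y"
  shows "secures_max (payoff matrix y x) (entries x)" and "secures_min (payoff matrix y x) (entries y)"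
  using assms unfolding saddle_point_def secures_max_def secures_min_def
  by (auto simp: entries_mixed simp flip: payoff_unit_vec_row payoff_unit_vec_col
      intro: unit_vec_strategy[unfolded Suc_eq_plus1[symmetric]])

lemma saddle_pointI:
  assumes "x \<in> strategies m" and "y \<in> strategies n"
    and "secures_max v (entries x)" and "secures_min v (entries y)"
  shows "saddle_point m n matrix x y"
proof -
  have ge: "v \<le> payoff matrix y' x" if "y' \<in> strategies n" for y'
  proof -
    note y' = entries_mixed[OF that]
    have "v = (\<Sum>i\<le>n. entries y' i * v)" using y' by (simp add: mixed_def flip: sum_distrib_right)
    also have "\<dots> \<le> payoff matrix y' x"
      unfolding payoff_eq_row[OF assms(1) that]
      using y' assms(3) by (intro sum_mono mult_left_mono) (auto simp: mixed_def secures_max_def)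
    finally show ?thesis .
  qed
  have le: "payoff matrix y x' \<le> v" if "x' \<in> strategies m" for x'
  proof -
    note x' = entries_mixed[OF that]
    have "payoff matrix y x' \<le> (\<Sum>j\<le>m. entries x' j * v)"
      unfolding payoff_eq_col[OF that assms(2)]
      using x' assms(4) by (intro sum_mono mult_left_mono) (auto simp: mixed_def secures_min_def)
    also have "\<dots> = v" using x' by (simp add: mixed_def flip: sum_distrib_right)
    finally show ?thesis .
  qed
  have "payoff matrix y x = v" using ge[OF assms(2)] le[OF assms(1)] by simp
  with ge le assms(1,2) show ?thesis by (simp add: saddle_point_def)
qed

text \<open>\<open>S\<close> itself is the partner of its reverse: both secure the payoff at the
  given saddle point.\<close>

lemma saddle_point_reverse:
  assumes "saddle_point m n matrix S T"
  shows "saddle_point m n matrix S (reverse_strategy n S)"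
proof -
  define v where "v = payoff matrix T S"
  have S: "S \<in> strategies m" using assms by (simp add: saddle_point_def)
  then have dim: "dim_vec S = Suc m" by (simp add: strategies_def)
  note sec = saddle_point_secures[OF assms, folded v_def]
  obtain l where l: "0 < l" "l \<le> Suc n" and supp: "\<And>j. 0 < entries S j \<longleftrightarrow> j < l"
    using support_initial[OF sec(2,1)] by metis
  have zero: "S $ j = 0" if "l \<le> j" "j \<le> m" for j
  proof (rule antisym)
    show "S $ j \<le> 0" using supp[of j] that by (simp add: entries_def dim)
    show "0 \<le> S $ j" using S that(2) by (simp add: strategies_def)
  qed
  have pos: "0 < S $ j" if "j < l" for j
    using supp[of j] that l n_le_m by (simp add: entries_def dim)
  \<comment> \<open>\<open>S\<close> is positive exactly on \<open>0, ..., l - 1\<close>, so its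
    length is \<open>l\<close>; with \<open>l \<le> Suc n\<close> the reverse gets dimension
    \<open>n + 1\<close>.\<close>
  have len: "strategy_length S = l"
    unfolding strategy_length_def
  proof (rule the_equality)
    show "0 < l \<and> l \<le> dim_vec S \<and> S $ (l - 1) \<noteq> 0 \<and> (\<forall>k. l \<le> k \<and> k < dim_vec S \<longrightarrow> S $ k = 0)"
    proof (intro conjI allI impI)
      show "0 < l" "l \<le> dim_vec S" using l n_le_m by (simp_all add: dim)
      show "S $ (l - 1) \<noteq> 0" using l(1) pos[of "l - 1"] by simp
      show "S $ k = 0" if "l \<le> k \<and> k < dim_vec S" for k using that zero by (simp add: dim)
    qed
    fix l' assume l': "0 < l' \<and> l' \<le> dim_vec S \<and> S $ (l' - 1) \<noteq> 0 \<and>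
      (\<forall>k. l' \<le> k \<and> k < dim_vec S \<longrightarrow> S $ k = 0)"
    then have "l' - 1 \<le> m" "S $ (l' - 1) \<noteq> 0" by (auto simp: dim)
    then have "l' - 1 < l" using zero[of "l' - 1"] by linarith
    moreover have "\<not> l' < l"
    proof
      assume "l' < l"
      with l' l n_le_m have "S $ l' = 0" by (simp add: dim)
      with pos[OF \<open>l' < l\<close>] show False by simp
    qed
    ultimately show "l' = l" using l' by linarith
  qed
  have "entries (reverse_strategy n S) = (\<lambda>i. if i < l then entries S (l - 1 - i) else 0)"
  proof
    fix i
    show "entries (reverse_strategy n S) i = (if i < l then entries S (l - 1 - i) else 0)"
      using l n_le_m by (auto simp: reverse_strategy_def len entries_def dim)
  qed
  then have R: "secures_min v (entries (reverse_strategy n S))"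
    using secures_min_reverse[OF sec(2,1) supp] by simp
  have "dim_vec (reverse_strategy n S) = n + 1" using l by (simp add: reverse_strategy_def len)
  with R have "reverse_strategy n S \<in> strategies n"
    by (simp only: strategies_iff secures_min_def)
  with R show ?thesis by (intro saddle_pointI[where v = v] S sec(1))
qed

end

section \<open>Monotonicity and duality of a single turn\<close>

lemma turn_payoff_strict_mono:
  fixes g h :: "'a \<Rightarrow> real"
  assumes fin: "finite X" "finite Y" and ne: "X \<union> Y \<noteq> {}" and less: "\<And>x. x \<in> X \<union> Y \<Longrightarrow> g x < h x"
  shows "turn_payoff w (g ` X) (g ` Y) < turn_payoff w (h ` X) (h ` Y)"
proof -
  have Max: "Max (g ` X) < Max (h ` X)" if "X \<noteq> {}"
    using fin that less by (subst Max_less_iff) (auto intro: less_le_trans[OF less] Max_ge)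
  have Min: "Min (g ` Y) < Min (h ` Y)" if "Y \<noteq> {}"
    using fin that less by (subst Min_gr_iff) (auto intro: le_less_trans[OF _ less] Min_le)
  show ?thesis
    using Max Min ne by (cases "X = {}"; cases "Y = {}"; cases w) (auto simp: turn_payoff_def)
qed

text \<open>Subtraction from 1 exchanges maxima and minima, matching the exchange of the move sets
  and of the bid winner.\<close>

lemma turn_payoff_one_minus:
  fixes g :: "'a \<Rightarrow> real"
  assumes fin: "finite X" "finite Y" and ne: "X \<union> Y \<noteq> {}"
  shows "turn_payoff (\<not> w) ((\<lambda>x. 1 - g x) ` Y) ((\<lambda>x. 1 - g x) ` X) = 1 - turn_payoff w (g ` X) (g ` Y)"
proof -
  have Max: "Max ((\<lambda>x. 1 - g x) ` Y) = 1 - Min (g ` Y)" if nonempty: "Y \<noteq> {}"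
  proof (rule Max_eqI)
    have "Min (g ` Y) \<in> g ` Y" using fin nonempty by (intro Min_in) auto
    then obtain z where z: "Min (g ` Y) = g z" "z \<in> Y" by (rule imageE)
    show "1 - Min (g ` Y) \<in> (\<lambda>x. 1 - g x) ` Y" unfolding z(1) using z(2) by (rule imageI)
  qed (use fin in auto)
  have Min: "Min ((\<lambda>x. 1 - g x) ` X) = 1 - Max (g ` X)" if nonempty: "X \<noteq> {}"
  proof (rule Min_eqI)
    have "Max (g ` X) \<in> g ` X" using fin nonempty by (intro Max_in) auto
    then obtain z where z: "Max (g ` X) = g z" "z \<in> X" by (rule imageE)
    show "1 - Max (g ` X) \<in> (\<lambda>x. 1 - g x) ` X" unfolding z(1) using z(2) by (rule imageI)
  qed (use fin in auto)
  show ?thesis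
    using Max Min ne
    by (cases "X = {}"; cases "Y = {}"; cases w) (auto simp: turn_payoff_def max_def min_def)
qed

section \<open>Reduction of a turn to a bid difference game\<close>

context bidding_game
begin

text \<open>Bids only move chips between the players, so with the total \<open>N\<close> fixed they
  matter only through A's new count \<open>c\<close> and the flag \<open>w\<close> for A winning the
  bid.\<close>

definition chip_value :: "'v \<Rightarrow> nat \<Rightarrow> bool \<Rightarrow> nat \<Rightarrow> real" where
  "chip_value G N w c = turn_payoff w ((\<lambda>G'. v_A G' c (N - c)) ` moves_A G) ((\<lambda>G'. v_A G' c (N - c)) ` moves_B G)"

lemma finite_moves: "finite (moves_A G)" "finite (moves_B G)"
proof -
  have "moves_A G \<subseteq> positions \<Gamma>" "moves_B G \<subseteq> positions \<Gamma>"
    using red_edges blue_edges by (auto simp: moves_A_def moves_B_def)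
  then show "finite (moves_A G)" "finite (moves_B G)" using finite_positions finite_subset by blast+
qed

lemma moves_nonempty:
  assumes "G \<in> positions \<Gamma>" "G \<noteq> mark_A \<Gamma>" "G \<noteq> mark_B \<Gamma>"
  shows "moves_A G \<union> moves_B G \<noteq> {}"
  using no_ties[OF assms] by (auto simp: moves_A_def moves_B_def)

lemma chip_value_less:
  assumes "G \<in> positions \<Gamma>" "G \<noteq> mark_A \<Gamma>" "G \<noteq> mark_B \<Gamma>" "precise G a b"
    and "c < c'" "c' \<le> a + b"
  shows "chip_value G (a + b) w c < chip_value G (a + b) w c'"
  unfolding chip_value_def
proof (rule turn_payoff_strict_mono[OF finite_moves moves_nonempty[OF assms(1-3)]])
  fix G' assume "G' \<in> moves_A G \<union> moves_B G"
  then have "strict_mono_on {0..a + b} (\<lambda>c. v_A G' c (a + b - c))" using assms(4) by (simp add: precise_def)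
  then show "v_A G' c (a + b - c) < v_A G' c' (a + b - c')"
    using assms(5,6) strict_mono_onD[of _ _ c c'] by fastforce
qed

lemma turn_payoff_eq_chip_value:
  assumes "i \<le> b" "j \<le> a"
  shows "turn_payoff w
      ((\<lambda>G'. v_A G' (a - j + i) (b - i + j)) ` moves_A G)
      ((\<lambda>G'. v_A G' (a - j + i) (b - i + j)) ` moves_B G) = chip_value G (a + b) w (a - j + i)"
proof -
  have "b - i + j = a + b - (a - j + i)" using assms by simp
  then show ?thesis by (simp add: chip_value_def)
qed

lemma M_B_payoff:
  assumes "G \<in> positions \<Gamma>" "G \<noteq> mark_A \<Gamma>" "G \<noteq> mark_B \<Gamma>" and "x \<in> strategies a" "y \<in> strategies b"
  shows "payoff (M_B G a b) x y = 1 - payoff (M_A G a b) y x"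
  unfolding M_A_def M_B_def v_B_def
  by (rule payoff_one_minus[OF assms(4,5)])
    (simp only: prod.case turn_payoff_one_minus[OF finite_moves moves_nonempty[OF assms(1-3)]])

lemma M_A_payoff:
  assumes "G \<in> positions \<Gamma>" "G \<noteq> mark_A \<Gamma>" "G \<noteq> mark_B \<Gamma>" and "x \<in> strategies a" "y \<in> strategies b"
  shows "payoff (M_A G a b) y x = 1 - payoff (M_B G a b) x y"
  using M_B_payoff[OF assms] by simp

text \<open>The two payoffs sum to 1, so B maximizes his own by minimizing A's.\<close>

lemma nash_iff_saddle_point_A:
  assumes "G \<in> positions \<Gamma>" "G \<noteq> mark_A \<Gamma>" "G \<noteq> mark_B \<Gamma>"
  shows "nash_equilibrium G a b x y \<longleftrightarrow> saddle_point a b (M_A G a b) x y"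
  by (auto simp: nash_equilibrium_def saddle_point_def M_B_payoff[OF assms])

lemma nash_iff_saddle_point_B:
  assumes "G \<in> positions \<Gamma>" "G \<noteq> mark_A \<Gamma>" "G \<noteq> mark_B \<Gamma>"
  shows "nash_equilibrium G a b x y \<longleftrightarrow> saddle_point b a (M_B G a b) y x"
  by (auto simp: nash_equilibrium_def saddle_point_def M_A_payoff[OF assms])

lemma equilibrium_B_reverse:
  assumes G: "G \<in> positions \<Gamma>" "G \<noteq> mark_A \<Gamma>" "G \<noteq> mark_B \<Gamma>" and precise: "precise G a b"
    and "b \<le> a" and S: "equilibrium_A G a b S"
  shows "equilibrium_B G a b (reverse_strategy b S)"
proof -
  \<comment> \<open>With \<open>d\<close> the bid of A minus that of B, A ends with
    \<open>a - d\<close> chips and, ties included, wins the bid iff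
    \<open>0 \<le> d\<close>.\<close>
  interpret bid_difference_game "\<lambda>d. chip_value G (a + b) (0 \<le> d) (nat (int a - d))" a b
    by unfold_locales (use assms in \<open>auto intro!: chip_value_less\<close>)
  have "M_A G a b = mat (b + 1) (a + 1) (\<lambda>(i, j). chip_value G (a + b) (wins_bid_A a b j i) (a - j + i))"
    unfolding M_A_def
    by (intro cong_mat)
      (simp_all only: prod.case turn_payoff_eq_chip_value less_Suc_eq_le Suc_eq_plus1[symmetric])
  also have "\<dots> = matrix"
    unfolding matrix_def using \<open>b \<le> a\<close>
    by (intro cong_mat)
      (auto simp: wins_bid_A_def advantage_A_def intro!: arg_cong2[of _ _ _ _ "chip_value G (a + b)"])
  finally have M: "M_A G a b = matrix" .
  from S obtain T where "saddle_point a b matrix S T"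
    unfolding equilibrium_A_def nash_iff_saddle_point_A[OF G] M by blast
  then show ?thesis
    unfolding equilibrium_B_def nash_iff_saddle_point_A[OF G] M by (blast intro: saddle_point_reverse)
qed

lemma equilibrium_A_reverse:
  assumes G: "G \<in> positions \<Gamma>" "G \<noteq> mark_A \<Gamma>" "G \<noteq> mark_B \<Gamma>" and precise: "precise G a b"
    and "a < b" and S: "equilibrium_B G a b S"
  shows "equilibrium_A G a b (reverse_strategy a S)"
proof -
  \<comment> \<open>Now \<open>d\<close> is the bid of B minus that of A: A ends with
    \<open>a + d\<close> chips and loses ties, so wins the bid iff \<open>d < 0\<close>. Subtraction
    from 1 makes the payoff decreasing on each side of 0.\<close>
  interpret bid_difference_game "\<lambda>d. 1 - chip_value G (a + b) (\<not> 0 \<le> d) (nat (int a + d))" b a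
    by unfold_locales (use assms in \<open>auto intro!: chip_value_less\<close>)
  have "M_B G a b = mat (a + 1) (b + 1) (\<lambda>(j, i). 1 - chip_value G (a + b) (wins_bid_A a b j i) (a - j + i))"
    unfolding M_B_def v_B_def
    by (intro cong_mat)
      (simp_all only: prod.case turn_payoff_one_minus[OF finite_moves moves_nonempty[OF G]] turn_payoff_eq_chip_value
        less_Suc_eq_le Suc_eq_plus1[symmetric])
  also have "\<dots> = matrix"
    unfolding matrix_def using \<open>a < b\<close>
    by (intro cong_mat)
      (auto simp: wins_bid_A_def advantage_A_def intro!: arg_cong2[of _ _ _ _ "chip_value G (a + b)"])
  finally have M: "M_B G a b = matrix" .
  from S obtain T where "saddle_point b a matrix S T"
    unfolding equilibrium_B_def nash_iff_saddle_point_B[OF G] M by blast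
  then show ?thesis
    unfolding equilibrium_A_def nash_iff_saddle_point_B[OF G] M by (blast intro: saddle_point_reverse)
qed

end

theorem theorem2p3:
  fixes \<Gamma> :: "'v bidding_graph" and G :: 'v and a b :: nat and S :: "real vec"
  assumes "bidding_game \<Gamma>"
    and "G \<in> positions \<Gamma>" and "G \<noteq> mark_A \<Gamma>" and "G \<noteq> mark_B \<Gamma>"
    and "bidding_game.precise \<Gamma> G a b"
  shows "(advantage_A a b \<and> bidding_game.equilibrium_A \<Gamma> G a b S \<longrightarrow>
            bidding_game.equilibrium_B \<Gamma> G a b (reverse_strategy b S)) \<and>
         (\<not> advantage_A a b \<and> bidding_game.equilibrium_B \<Gamma> G a b S \<longrightarrow>
            bidding_game.equilibrium_A \<Gamma> G a b (reverse_strategy a S))"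
proof -
  interpret bidding_game \<Gamma> by fact
  show ?thesis
    using equilibrium_B_reverse[OF assms(2-5)] equilibrium_A_reverse[OF assms(2-5)]
    by (auto simp: advantage_A_def not_le)
qed

end
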